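(* Let $R$ be a dedekind type domain, let $\mathit{M}(R)$ be the monoid generated by the maximal ideals of $R$, and let $\mathcal{I},\mathcal{J}\in\mathit{M}(R)$ be comaximal. Then the map $SL_2(R)\to\mathbb{PF}^1_{\mathcal{I}}\times\mathbb{PF}^1_{\mathcal{J}}$, $\begin{pmatrix}a&b\\c&d\end{pmatrix}\mapsto([a:b],[c:d])$, is surjective.
   Context: Dedekind type domain: a commutative ring $R$ with unity which is a field, or in which every maximal ideal $\mathcal{M}$ satisfies $\mathcal{M}^i\neq\mathcal{M}^{i+1}$ ($i\ge0$), $\bigcap_{i\ge0}\mathcal{M}^i=(0)$, $\dim_{R/\mathcal{M}}\mathcal{M}^i/\mathcal{M}^{i+1}=1$ ($i\ge0$), and every nonzero element lies in only finitely many maximal ideals. $\mathit{M}(R)$ is the set of finite products of maximal ideals ($R$ the empty product). For an ideal $\mathcal{I}$, $\mathbb{PF}^1_{\mathcal{I}}$ is the set of pairs $(a,b)$ with $(a,b)=R$ modulo the equivalence $(a,b)\sim(c,d)\iff ad-bc\in\mathcal{I}$; $[a:b]$ denotes the class. *)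

theory Defs
  imports
    "HOL-Algebra.Ideal_Product"
    "HOL-Algebra.QuotRing"
    "Jordan_Normal_Form.Missing_VectorSpace"
begin

section \<open>Dedekind type domains\<close>

abbreviation ideal_power :: "('a, 'b) ring_scheme \<Rightarrow> 'a set \<Rightarrow> nat \<Rightarrow> 'a set"
  where "ideal_power R M i \<equiv> M [^]\<^bsub>ideals_set R\<^esub> i"

text \<open>
  The quotient \<open>A / B\<close> of ideals \<open>B \<subseteq> A\<close> with \<open>M A \<subseteq> B\<close>, as a module over \<open>R / M\<close>. If \<open>S\<close> is a
  coset of \<open>M\<close> and \<open>T\<close> is a coset of \<open>B\<close> inside \<open>A\<close>, then \<open>rcoset_mult R B S T\<close> is the union of the
  cosets of \<open>B\<close> represented by \<open>s t\<close> for \<open>s \<in> S\<close>, \<open>t \<in> T\<close>; these all coincide, so it is the coset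
  \<open>S T\<close>. The fields \<open>mult\<close> and \<open>one\<close> play no role in a module.
\<close>

definition ideal_quot_module ::
    "('a, 'b) ring_scheme \<Rightarrow> 'a set \<Rightarrow> 'a set \<Rightarrow> ('a set, 'a set) module"
  where "ideal_quot_module R A B =
    \<lparr>carrier = a_r_coset R B ` A, mult = undefined, one = undefined,
     zero = B, add = set_add R, smult = rcoset_mult R B\<rparr>"

abbreviation graded_piece ::
    "('a, 'b) ring_scheme \<Rightarrow> 'a set \<Rightarrow> nat \<Rightarrow> ('a set, 'a set) module"
  where "graded_piece R M i \<equiv>
    ideal_quot_module R (ideal_power R M i) (ideal_power R M (Suc i))"

text \<open>
  \<^const>\<open>vectorspace.dim\<close> is only meaningful together with \<^const>\<open>vectorspace.fin_dim\<close>.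
\<close>

definition dedekind_type :: "('a, 'b) ring_scheme \<Rightarrow> bool"
  where "dedekind_type R \<longleftrightarrow> cring R \<and>
    (field R \<or>
      (\<forall>M. maximalideal M R \<longrightarrow>
        (\<forall>i. ideal_power R M i \<noteq> ideal_power R M (Suc i)) \<and>
        (\<Inter>i. ideal_power R M i) = {\<zero>\<^bsub>R\<^esub>} \<and>
        (\<forall>i. vectorspace.fin_dim (R Quot M) (graded_piece R M i) \<and>
             vectorspace.dim (R Quot M) (graded_piece R M i) = 1)) \<and>
      (\<forall>x \<in> carrier R. x \<noteq> \<zero>\<^bsub>R\<^esub> \<longrightarrow> finite {M. maximalideal M R \<and> x \<in> M}))"

inductive_set maximal_ideal_monoid :: "('a, 'b) ring_scheme \<Rightarrow> 'a set set"
  for R where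
    one: "carrier R \<in> maximal_ideal_monoid R"
  | mult: "\<lbrakk>maximalideal M R; I \<in> maximal_ideal_monoid R\<rbrakk>
           \<Longrightarrow> ideal_prod R M I \<in> maximal_ideal_monoid R"


section \<open>The sets \<open>PF\<^sup>1\<close> and \<open>SL\<^sub>2\<close>\<close>

definition unimodular_pairs :: "('a, 'b) ring_scheme \<Rightarrow> ('a \<times> 'a) set"
  where "unimodular_pairs R =
    {(a, b). a \<in> carrier R \<and> b \<in> carrier R \<and> Idl\<^bsub>R\<^esub> {a, b} = carrier R}"

definition PF1_rel :: "('a, 'b) ring_scheme \<Rightarrow> 'a set \<Rightarrow> (('a \<times> 'a) \<times> ('a \<times> 'a)) set"
  where "PF1_rel R I =
    {((a, b), (c, d)). (a, b) \<in> unimodular_pairs R \<and> (c, d) \<in> unimodular_pairs R \<and>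
       a \<otimes>\<^bsub>R\<^esub> d \<ominus>\<^bsub>R\<^esub> b \<otimes>\<^bsub>R\<^esub> c \<in> I}"

definition PF1 :: "('a, 'b) ring_scheme \<Rightarrow> 'a set \<Rightarrow> ('a \<times> 'a) set set"
  where "PF1 R I = unimodular_pairs R // PF1_rel R I"

definition PF1_class :: "('a, 'b) ring_scheme \<Rightarrow> 'a set \<Rightarrow> 'a \<Rightarrow> 'a \<Rightarrow> ('a \<times> 'a) set"
  where "PF1_class R I a b = PF1_rel R I `` {(a, b)}"

text \<open>A \<open>2 \<times> 2\<close> matrix is the pair of its rows.\<close>

definition SL2 :: "('a, 'b) ring_scheme \<Rightarrow> (('a \<times> 'a) \<times> ('a \<times> 'a)) set"
  where "SL2 R =
    {((a, b), (c, d)). a \<in> carrier R \<and> b \<in> carrier R \<and> c \<in> carrier R \<and> d \<in> carrier R \<and>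
       a \<otimes>\<^bsub>R\<^esub> d \<ominus>\<^bsub>R\<^esub> b \<otimes>\<^bsub>R\<^esub> c = \<one>\<^bsub>R\<^esub>}"

definition row_classes ::
    "('a, 'b) ring_scheme \<Rightarrow> 'a set \<Rightarrow> 'a set \<Rightarrow> ('a \<times> 'a) \<times> ('a \<times> 'a) \<Rightarrow>
     ('a \<times> 'a) set \<times> ('a \<times> 'a) set"
  where "row_classes R I J = (\<lambda>((a, b), (c, d)). (PF1_class R I a b, PF1_class R J c d))"


section \<open>Well-definedness\<close>

lemma (in cring) ideal_ideal_power:
  assumes "ideal M R"
  shows "ideal (ideal_power R M i) R"
proof -
  interpret S: comm_monoid "ideals_set R" by (rule ideals_set_is_comm_monoid)
  have "M \<in> carrier (ideals_set R)" using assms by (simp add: ideals_set_def)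
  then have "ideal_power R M i \<in> carrier (ideals_set R)" by (rule S.nat_pow_closed)
  then show ?thesis by (simp add: ideals_set_def)
qed

lemma (in cring) ideal_power_Suc:
  shows "ideal_power R M (Suc i) = ideal_prod R (ideal_power R M i) M"
  by (simp add: nat_pow_def ideals_set_def)

lemma (in cring) rcoset_mult_quot:
  assumes M: "ideal M R" and A: "ideal A R" and B: "ideal B R"
    and MA: "\<And>m a. m \<in> M \<Longrightarrow> a \<in> A \<Longrightarrow> m \<otimes> a \<in> B" and BA: "B \<subseteq> A"
    and r: "r \<in> carrier R" and x: "x \<in> A"
  shows "rcoset_mult R B (M +> r) (B +> x) = B +> (r \<otimes> x)"
proof -
  interpret M: ideal M R by fact
  interpret A: ideal A R by fact
  interpret B: ideal B R by fact
  have xc: "x \<in> carrier R" using x by (rule A.Icarr)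
  have eq: "B +> (s \<otimes> t) = B +> (r \<otimes> x)" if s: "s \<in> M +> r" and t: "t \<in> B +> x" for s t
  proof -
    from s obtain m where m: "m \<in> M" "s = m \<oplus> r" unfolding a_r_coset_def' by auto
    from t obtain b where b: "b \<in> B" "t = b \<oplus> x" unfolding a_r_coset_def' by auto
    have mc: "m \<in> carrier R" and bc: "b \<in> carrier R" using m b M.Icarr B.Icarr by auto
    have 1: "m \<otimes> b \<in> B" "m \<otimes> x \<in> B" "r \<otimes> b \<in> B"
      using MA m b BA x r mc B.I_l_closed by auto
    have "s \<otimes> t \<ominus> r \<otimes> x = m \<otimes> b \<oplus> m \<otimes> x \<oplus> r \<otimes> b"
      unfolding m b using mc bc xc r by algebra
    also have "\<dots> \<in> B" using 1 by auto
    finally show ?thesis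
      using quotient_eq_iff_same_a_r_cos[OF B] m b mc bc r xc by simp
  qed
  moreover have "r \<in> M +> r" "x \<in> B +> x"
    using M.a_rcos_self r B.a_rcos_self xc by auto
  ultimately show ?thesis unfolding rcoset_mult_def by blast
qed

lemma (in cring) module_ideal_quot_module:
  assumes M: "ideal M R" and A: "ideal A R" and B: "ideal B R"
    and MA: "\<And>m a. m \<in> M \<Longrightarrow> a \<in> A \<Longrightarrow> m \<otimes> a \<in> B" and BA: "B \<subseteq> A"
  shows "module (R Quot M) (ideal_quot_module R A B)"
proof -
  interpret M: ideal M R by fact
  interpret A: ideal A R by fact
  interpret B: ideal B R by fact
  note cA = A.Icarr
  note sm = rcoset_mult_quot[OF assms]
  have B0: "B = B +> \<zero>" using a_rcos_zero[OF B B.zero_closed] by simp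
  have ab: "abelian_group (ideal_quot_module R A B)"
  proof (rule abelian_groupI)
    show "\<zero>\<^bsub>ideal_quot_module R A B\<^esub> \<in> carrier (ideal_quot_module R A B)"
      using B0 A.zero_closed by (auto simp: ideal_quot_module_def)
  next
    fix x assume "x \<in> carrier (ideal_quot_module R A B)"
    then obtain a where a: "a \<in> A" "x = B +> a" by (auto simp: ideal_quot_module_def)
    show "\<zero>\<^bsub>ideal_quot_module R A B\<^esub> \<oplus>\<^bsub>ideal_quot_module R A B\<^esub> x = x"
      using B.a_rcos_sum[of \<zero> a] a cA B0 by (auto simp: ideal_quot_module_def)
    have "(B +> (\<ominus> a)) <+> x = B"
      using B.a_rcos_sum[of "\<ominus> a" a] a cA B0 by (auto simp: l_neg)
    then show "\<exists>y\<in>carrier (ideal_quot_module R A B).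
        y \<oplus>\<^bsub>ideal_quot_module R A B\<^esub> x = \<zero>\<^bsub>ideal_quot_module R A B\<^esub>"
      using a by (auto simp: ideal_quot_module_def)
  next
    fix x y z
    assume "x \<in> carrier (ideal_quot_module R A B)" "y \<in> carrier (ideal_quot_module R A B)"
      "z \<in> carrier (ideal_quot_module R A B)"
    then show "x \<oplus>\<^bsub>ideal_quot_module R A B\<^esub> y \<oplus>\<^bsub>ideal_quot_module R A B\<^esub> z =
        x \<oplus>\<^bsub>ideal_quot_module R A B\<^esub> (y \<oplus>\<^bsub>ideal_quot_module R A B\<^esub> z)"
      by (auto simp add: ideal_quot_module_def B.a_rcos_sum cA a_assoc)
  next
    fix x y
    assume "x \<in> carrier (ideal_quot_module R A B)" "y \<in> carrier (ideal_quot_module R A B)"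
    then obtain a b where "a \<in> A" "b \<in> A" "x = B +> a" "y = B +> b"
      by (auto simp: ideal_quot_module_def)
    then show "x \<oplus>\<^bsub>ideal_quot_module R A B\<^esub> y = y \<oplus>\<^bsub>ideal_quot_module R A B\<^esub> x"
      by (simp add: ideal_quot_module_def B.a_rcos_sum cA a_comm[of a b])
  qed (auto simp: ideal_quot_module_def B.a_rcos_sum cA)
  show ?thesis
  proof (rule moduleI[OF M.quotient_is_cring[OF is_cring] ab], goal_cases)
    case (1 a x)
    then show ?case
      by (auto simp: ideal_quot_module_def FactRing_simps sm A.I_l_closed)
  next
    case (2 a b x)
    then show ?case
      by (auto simp: ideal_quot_module_def FactRing_simps sm M.a_rcos_sum B.a_rcos_sum cA
          A.I_l_closed l_distr)
  next
    case (3 a x y)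
    then show ?case
      by (auto simp: ideal_quot_module_def FactRing_simps sm B.a_rcos_sum cA A.I_l_closed r_distr)
  next
    case (4 a b x)
    then show ?case
      by (auto simp: ideal_quot_module_def FactRing_simps sm M.rcoset_mult_add cA
          A.I_l_closed m_assoc)
  next
    case (5 x)
    then show ?case
      by (auto simp: ideal_quot_module_def FactRing_simps sm cA)
  qed
qed

lemma (in cring) vectorspace_graded_piece:
  assumes "maximalideal M R"
  shows "vectorspace (R Quot M) (graded_piece R M i)"
proof -
  interpret M: maximalideal M R by fact
  note M = M.is_ideal
  note P = ideal_ideal_power[OF M]
  have 1: "m \<otimes> a \<in> ideal_power R M (Suc i)" if "m \<in> M" "a \<in> ideal_power R M i" for m a
  proof -
    have "a \<otimes> m \<in> ideal_power R M (Suc i)"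
      unfolding ideal_power_Suc using that by (intro ideal_prod.prod)
    then show ?thesis
      using that M.Icarr ideal.Icarr[OF P] by (metis m_comm)
  qed
  have "ideal_power R M (Suc i) \<subseteq> ideal_power R M i"
    unfolding ideal_power_Suc using ideal_prod_inter[OF P M] by blast
  then have "module (R Quot M) (graded_piece R M i)"
    using module_ideal_quot_module[OF M P P 1] by blast
  moreover have "field (R Quot M)" by (rule M.quotient_is_field[OF is_cring])
  ultimately show ?thesis by (simp add: vectorspace_def)
qed

lemma (in cring) Idl_pair:
  assumes "a \<in> carrier R" "b \<in> carrier R"
  shows "Idl {a, b} = {u \<otimes> a \<oplus> v \<otimes> b | u v. u \<in> carrier R \<and> v \<in> carrier R}" (is "_ = ?S")
proof
  have S: "ideal ?S R"
  proof (rule idealI[OF ring_axioms])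
    show "subgroup ?S (add_monoid R)"
    proof (rule add.subgroupI)
      show "?S \<subseteq> carrier R" using assms by auto
      show "?S \<noteq> {}" by auto
    next
      fix s assume "s \<in> ?S"
      then obtain u v where uv: "u \<in> carrier R" "v \<in> carrier R" "s = u \<otimes> a \<oplus> v \<otimes> b" by auto
      have "\<ominus> s = (\<ominus> u) \<otimes> a \<oplus> (\<ominus> v) \<otimes> b" unfolding uv using uv(1,2) assms by algebra
      then show "\<ominus> s \<in> ?S" using uv by blast
    next
      fix s t assume "s \<in> ?S" "t \<in> ?S"
      then obtain u v w z where uv: "u \<in> carrier R" "v \<in> carrier R" "s = u \<otimes> a \<oplus> v \<otimes> b"
        "w \<in> carrier R" "z \<in> carrier R" "t = w \<otimes> a \<oplus> z \<otimes> b" by auto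
      have "s \<oplus> t = (u \<oplus> w) \<otimes> a \<oplus> (v \<oplus> z) \<otimes> b" unfolding uv using uv(1,2,4,5) assms by algebra
      then show "s \<oplus> t \<in> ?S" using uv by blast
    qed
  next
    fix s x assume "s \<in> ?S" and x: "x \<in> carrier R"
    then obtain u v where uv: "u \<in> carrier R" "v \<in> carrier R" "s = u \<otimes> a \<oplus> v \<otimes> b" by auto
    have "x \<otimes> s = (x \<otimes> u) \<otimes> a \<oplus> (x \<otimes> v) \<otimes> b" unfolding uv using uv(1,2) x assms by algebra
    then show "x \<otimes> s \<in> ?S" using uv x by blast
    moreover have "s \<otimes> x = x \<otimes> s" using x uv assms by (simp add: m_comm)
    ultimately show "s \<otimes> x \<in> ?S" by simp
  qed
  have "a = \<one> \<otimes> a \<oplus> \<zero> \<otimes> b" "b = \<zero> \<otimes> a \<oplus> \<one> \<otimes> b" using assms by auto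
  then have "{a, b} \<subseteq> ?S" by blast
  then show "Idl {a, b} \<subseteq> ?S" by (rule genideal_minimal[OF S])
next
  interpret G: ideal "Idl {a, b}" R using assms by (intro genideal_ideal) auto
  have "a \<in> Idl {a, b}" "b \<in> Idl {a, b}" using genideal_self[of "{a, b}"] assms by auto
  then show "?S \<subseteq> Idl {a, b}" using G.I_l_closed by auto
qed

lemma (in cring) unimodular_pairs_iff:
  "(a, b) \<in> unimodular_pairs R \<longleftrightarrow> a \<in> carrier R \<and> b \<in> carrier R \<and>
     (\<exists>u \<in> carrier R. \<exists>v \<in> carrier R. u \<otimes> a \<oplus> v \<otimes> b = \<one>)"
proof (cases "a \<in> carrier R \<and> b \<in> carrier R")
  case True
  then interpret G: ideal "Idl {a, b}" R by (intro genideal_ideal) auto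
  have "Idl {a, b} = carrier R \<longleftrightarrow> \<one> \<in> Idl {a, b}"
    using G.one_imp_carrier by auto
  also have "\<dots> \<longleftrightarrow> (\<exists>u \<in> carrier R. \<exists>v \<in> carrier R. u \<otimes> a \<oplus> v \<otimes> b = \<one>)"
    using True by (subst Idl_pair) (auto intro: sym)
  finally show ?thesis using True by (simp add: unimodular_pairs_def)
qed (auto simp: unimodular_pairs_def)

lemma (in cring) equiv_PF1_rel:
  assumes "ideal I R"
  shows "equiv (unimodular_pairs R) (PF1_rel R I)"
proof -
  interpret I: ideal I R by fact
  show ?thesis
  proof (rule equivI)
    show "PF1_rel R I \<subseteq> unimodular_pairs R \<times> unimodular_pairs R"
      by (auto simp: PF1_rel_def)
    have "a \<otimes> b \<ominus> b \<otimes> a \<in> I" if "a \<in> carrier R" "b \<in> carrier R" for a b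
    proof -
      have "a \<otimes> b \<ominus> b \<otimes> a = \<zero>" using that by algebra
      then show ?thesis using I.zero_closed by simp
    qed
    then show "refl_on (unimodular_pairs R) (PF1_rel R I)"
      by (auto simp: PF1_rel_def refl_on_def unimodular_pairs_def)
    show "sym (PF1_rel R I)"
    proof (rule symI, clarify)
      fix a b c d assume "((a, b), (c, d)) \<in> PF1_rel R I"
      then have *: "(a, b) \<in> unimodular_pairs R" "(c, d) \<in> unimodular_pairs R"
        "a \<otimes> d \<ominus> b \<otimes> c \<in> I" by (auto simp: PF1_rel_def)
      then have "a \<in> carrier R" "b \<in> carrier R" "c \<in> carrier R" "d \<in> carrier R"
        by (auto simp: unimodular_pairs_def)
      then have "c \<otimes> b \<ominus> d \<otimes> a = \<ominus> (a \<otimes> d \<ominus> b \<otimes> c)" by algebra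
      then show "((c, d), (a, b)) \<in> PF1_rel R I" using * by (simp add: PF1_rel_def)
    qed
    show "trans (PF1_rel R I)"
    proof (rule transI, clarify)
      fix a b c d e f
      assume "((a, b), (c, d)) \<in> PF1_rel R I" "((c, d), (e, f)) \<in> PF1_rel R I"
      then have *: "(a, b) \<in> unimodular_pairs R" "(c, d) \<in> unimodular_pairs R"
        "(e, f) \<in> unimodular_pairs R"
        "a \<otimes> d \<ominus> b \<otimes> c \<in> I" "c \<otimes> f \<ominus> d \<otimes> e \<in> I" by (auto simp: PF1_rel_def)
      have carr: "a \<in> carrier R" "b \<in> carrier R" "c \<in> carrier R" "d \<in> carrier R"
        "e \<in> carrier R" "f \<in> carrier R"
        using * by (auto simp: unimodular_pairs_def)
      from *(2) obtain u v where uv: "u \<in> carrier R" "v \<in> carrier R" "u \<otimes> c \<oplus> v \<otimes> d = \<one>"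
        by (auto simp: unimodular_pairs_iff)
      have "a \<otimes> f \<ominus> b \<otimes> e = (u \<otimes> c \<oplus> v \<otimes> d) \<otimes> (a \<otimes> f \<ominus> b \<otimes> e)"
        unfolding uv(3) using carr by simp
      also have "\<dots> = (u \<otimes> a \<oplus> v \<otimes> b) \<otimes> (c \<otimes> f \<ominus> d \<otimes> e) \<oplus> (u \<otimes> e \<oplus> v \<otimes> f) \<otimes> (a \<otimes> d \<ominus> b \<otimes> c)"
        using carr uv(1,2) by algebra
      also have "\<dots> \<in> I"
        using * carr uv(1,2) by (intro I.a_closed I.I_l_closed) auto
      finally show "((a, b), (e, f)) \<in> PF1_rel R I" using * by (simp add: PF1_rel_def)
    qed
  qed
qed

lemma (in cring) SL2_rows_unimodular:
  assumes "((a, b), (c, d)) \<in> SL2 R"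
  shows "(a, b) \<in> unimodular_pairs R" "(c, d) \<in> unimodular_pairs R"
proof -
  have *: "a \<in> carrier R" "b \<in> carrier R" "c \<in> carrier R" "d \<in> carrier R"
    and det: "a \<otimes> d \<ominus> b \<otimes> c = \<one>"
    using assms by (auto simp: SL2_def)
  have "d \<otimes> a \<oplus> (\<ominus> c) \<otimes> b = \<one>" "(\<ominus> b) \<otimes> c \<oplus> a \<otimes> d = \<one>"
    unfolding det[symmetric] using * by algebra+
  then show "(a, b) \<in> unimodular_pairs R" "(c, d) \<in> unimodular_pairs R"
    using * unimodular_pairs_iff a_inv_closed by blast+
qed

end

theory Submission
  imports Defs "HOL-Algebra.Ring_Divisibility"
begin

text \<open>
  A nonzero element lies in finitely many maximal ideals, which allows a pair that is unimodular
  modulo an ideal \<open>K\<close> to be lifted to a unimodular pair: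
  make the second entry nonzero, then shift the first entry by an element of \<open>K\<close> so that it
  avoids the finitely many maximal ideals that contain the second entry but not \<open>K\<close>.

  Right multiplication by \<open>SL\<^sub>2\<close> reduces the first row to \<open>(1, 0)\<close>, and the second to some \<open>(c', d')\<close>.
  By comaximality some pair is congruent to \<open>(0, 1)\<close> modulo \<open>I\<close> and to \<open>(c', d')\<close>
  modulo \<open>J\<close>; a unimodular lift \<open>(r, s)\<close> modulo \<open>I \<inter> J\<close>, with \<open>x r + y s = 1\<close>, is the second row of the
  determinant one matrix whose first row is \<open>(y + x r, x (s - 1))\<close>.
\<close>

section \<open>Maximal ideals as a test for unimodularity\<close>

text \<open>Zorn's lemma applies to the ideals above \<open>A\<close> that omit
  \<open>\<one>\<close>: properness, written in this form, visibly survives unions of nonempty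
  chains.\<close>

lemma (in cring) exists_maximalideal_superset:
  assumes A: "ideal A R" "A \<noteq> carrier R"
  obtains M where "maximalideal M R" "A \<subseteq> M"
proof -
  let ?S = "{B. ideal B R \<and> A \<subseteq> B \<and> \<one> \<notin> B}"
  have one_notin: "\<one> \<notin> A" using A ideal.one_imp_carrier by blast
  have "\<exists>M\<in>?S. \<forall>X\<in>?S. M \<subseteq> X \<longrightarrow> X = M"
  proof (rule subset_Zorn_nonempty)
    show "?S \<noteq> {}" using A one_notin by blast
  next
    fix C assume C: "C \<noteq> {}" "subset.chain ?S C"
    then have sub: "C \<subseteq> ?S" unfolding subset.chain_def by blast
    then have "subset.chain {I. ideal I R} C"
      using C unfolding subset.chain_def by blast
    then have "ideal (\<Union>C) R" using C(1) chain_Union_is_ideal[of C] by simp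
    then show "\<Union>C \<in> ?S" using sub C(1) by auto
  qed
  then obtain M where M: "ideal M R" "A \<subseteq> M" "\<one> \<notin> M"
    and max: "\<And>X. ideal X R \<Longrightarrow> A \<subseteq> X \<Longrightarrow> \<one> \<notin> X \<Longrightarrow> M \<subseteq> X \<Longrightarrow> X = M" by auto
  have "maximalideal M R"
  proof (rule maximalidealI)
    show "carrier R \<noteq> M" using M by auto
    show "X = M \<or> X = carrier R" if "ideal X R" "M \<subseteq> X" for X
      using max[OF that(1)] that M ideal.one_imp_carrier[OF that(1)] by blast
  qed (fact M)
  then show ?thesis using that M(2) by blast
qed

text \<open>If \<open>Idl {a, b}\<close> were proper, some maximal ideal above it would contain both
  entries.\<close>

lemma (in cring) unimodular_pairsI_maximalideal:
  assumes "a \<in> carrier R" "b \<in> carrier R"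
    and "\<And>M. maximalideal M R \<Longrightarrow> a \<in> M \<Longrightarrow> b \<notin> M"
  shows "(a, b) \<in> unimodular_pairs R"
proof (rule ccontr)
  assume "(a, b) \<notin> unimodular_pairs R"
  then have "Idl {a, b} \<noteq> carrier R" using assms by (simp add: unimodular_pairs_def)
  then obtain M where "maximalideal M R" "Idl {a, b} \<subseteq> M"
    using exists_maximalideal_superset[of "Idl {a, b}"] genideal_ideal assms by auto
  then show False using assms genideal_self[of "{a, b}"] by auto
qed

section \<open>Lifting pairs that are unimodular modulo an ideal\<close>

text \<open>Start with an element of \<open>K\<close> outside \<open>N\<close> and multiply it, for
  each \<open>M\<close> in \<open>F\<close>, by an element of \<open>M\<close> outside
  \<open>N\<close>. Distinct maximal ideals are incomparable, so such factors exist, and the product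
  stays outside \<open>N\<close> because \<open>N\<close> is prime.\<close>

lemma (in cring) exists_mem_finite_maximalideals:
  assumes "finite F" "\<And>M. M \<in> F \<Longrightarrow> maximalideal M R \<and> M \<noteq> N"
    and N: "maximalideal N R" and K: "ideal K R" "\<not> K \<subseteq> N"
  shows "\<exists>x\<in>K. x \<notin> N \<and> (\<forall>M\<in>F. x \<in> M)"
  using assms(1,2)
proof (induction F)
  case empty
  then show ?case using K by auto
next
  case (insert M F)
  interpret K: ideal K R by fact
  interpret N: maximalideal N R by fact
  interpret N': primeideal N R by (rule maximalideal_prime[OF N])
  interpret M: maximalideal M R using insert.prems by auto
  obtain x where x: "x \<in> K" "x \<notin> N" "\<And>L. L \<in> F \<Longrightarrow> x \<in> L" using insert by auto
  have "\<not> M \<subseteq> N"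
    using M.I_maximal[OF N.is_ideal] N.a_subset N.I_notcarr insert.prems by auto
  then obtain m where m: "m \<in> M" "m \<notin> N" by auto
  have carr: "x \<in> carrier R" "m \<in> carrier R" using x m by auto
  have "m \<otimes> x \<in> K" "m \<otimes> x \<in> M" using x m carr by (auto intro: K.I_l_closed M.I_r_closed)
  moreover have "m \<otimes> x \<notin> N" using N'.I_prime carr m x by blast
  moreover have "m \<otimes> x \<in> L" if "L \<in> F" for L
  proof -
    have "ideal L R" using insert.prems that by (auto simp: maximalideal_def)
    then show ?thesis by (rule ideal.I_l_closed) (use x(3)[OF that] carr in auto)
  qed
  ultimately show ?case by blast
qed

text \<open>The ideals are avoided one at a time. If the current shift lands in the new ideal
  \<open>N\<close>, adding an element of \<open>K\<close> that lies in all earlier ideals but not in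
  \<open>N\<close> leaves the earlier memberships unchanged and moves the sum out of
  \<open>N\<close>.\<close>

lemma (in cring) exists_shift_avoiding_maximalideals:
  assumes "finite F" "\<And>M. M \<in> F \<Longrightarrow> maximalideal M R \<and> \<not> K \<subseteq> M"
    and K: "ideal K R" and r: "r \<in> carrier R"
  shows "\<exists>k\<in>K. \<forall>M\<in>F. r \<oplus> k \<notin> M"
  using assms(1,2)
proof (induction F)
  case empty
  interpret K: ideal K R by fact
  show ?case using K.zero_closed by blast
next
  case (insert N F)
  interpret K: ideal K R by fact
  obtain k where k: "k \<in> K" "\<And>M. M \<in> F \<Longrightarrow> r \<oplus> k \<notin> M" using insert by auto
  show ?case
  proof (cases "r \<oplus> k \<in> N")
    case False
    then show ?thesis using k by auto
  next
    case True
    have N: "maximalideal N R" "\<not> K \<subseteq> N" using insert.prems by auto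
    have "\<And>M. M \<in> F \<Longrightarrow> maximalideal M R \<and> M \<noteq> N" using insert by auto
    from exists_mem_finite_maximalideals[OF insert.hyps(1) this N(1) K N(2)]
    obtain x where x: "x \<in> K" "x \<notin> N" "\<And>M. M \<in> F \<Longrightarrow> x \<in> M" by auto
    have carr: "k \<in> carrier R" "x \<in> carrier R" using k x by auto
    have mem_iff: "r \<oplus> (k \<oplus> x) \<in> M \<longleftrightarrow> r \<oplus> k \<in> M" if "maximalideal M R" "x \<in> M" for M
    proof -
      interpret M: maximalideal M R by fact
      have "r \<oplus> k = (r \<oplus> (k \<oplus> x)) \<ominus> x" "r \<oplus> (k \<oplus> x) = (r \<oplus> k) \<oplus> x"
        using carr r by algebra+
      then show ?thesis using that(2) by (metis M.a_closed M.a_inv_closed minus_eq)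
    qed
    have "r \<oplus> (k \<oplus> x) \<notin> N"
    proof
      interpret N: maximalideal N R using insert.prems by auto
      assume "r \<oplus> (k \<oplus> x) \<in> N"
      moreover have "x = (r \<oplus> (k \<oplus> x)) \<ominus> (r \<oplus> k)" using carr r by algebra
      ultimately show False using True x(2) by (metis N.a_closed N.a_inv_closed minus_eq)
    qed
    moreover have "r \<oplus> (k \<oplus> x) \<notin> M" if "M \<in> F" for M
      using mem_iff[of M] insert.prems that x(3) k(2) by auto
    ultimately show ?thesis using k x by auto
  qed
qed

text \<open>At maximal ideals containing \<open>K\<close> the shifts by \<open>k\<close> and
  \<open>l\<close> are invisible and \<open>unim\<close> decides; the others that contain the second
  entry form the finite set \<open>F\<close>, which the first entry is made to avoid.\<close>

lemma (in cring) exists_unimodular_lift: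
  assumes fin: "\<And>x. x \<in> carrier R \<Longrightarrow> x \<noteq> \<zero> \<Longrightarrow> finite {M. maximalideal M R \<and> x \<in> M}"
    and K: "ideal K R" and r: "r \<in> carrier R" and s: "s \<in> carrier R"
    and unim: "\<And>M. maximalideal M R \<Longrightarrow> K \<subseteq> M \<Longrightarrow> r \<in> M \<Longrightarrow> s \<notin> M"
  obtains k l where "k \<in> K" "l \<in> K" "(r \<oplus> k, s \<oplus> l) \<in> unimodular_pairs R"
proof -
  interpret K: ideal K R by fact
  \<comment> \<open>The second entry can be forced to stay zero only when \<open>K\<close> is zero.
    In that case every maximal ideal contains \<open>K\<close>, so \<open>F\<close> below is empty
    and finiteness still holds.\<close>
  obtain l where l: "l \<in> K" "s \<oplus> l = \<zero> \<Longrightarrow> K = {\<zero>}"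
  proof (cases "s = \<zero>")
    case True
    show ?thesis
    proof (cases "K = {\<zero>}")
      case True
      then show ?thesis using that[of \<zero>] by simp
    next
      case False
      then obtain l where "l \<in> K" "l \<noteq> \<zero>" using K.zero_closed by blast
      then show ?thesis using that[of l] \<open>s = \<zero>\<close> by simp
    qed
  next
    case False
    then show ?thesis using that[of \<zero>] K.zero_closed s by auto
  qed
  have lc: "l \<in> carrier R" using l by auto
  define F where "F = {M. maximalideal M R \<and> s \<oplus> l \<in> M \<and> \<not> K \<subseteq> M}"
  have "finite F"
  proof (cases "s \<oplus> l = \<zero>")
    case True
    then have "K = {\<zero>}" by (rule l(2))
    then have "F = {}"
      by (auto simp: F_def maximalideal_def ideal_def intro: additive_subgroup.zero_closed)
    then show ?thesis by simp
  next
    case False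
    then have "finite {M. maximalideal M R \<and> s \<oplus> l \<in> M}" using fin s lc by blast
    then show ?thesis by (rule rev_finite_subset) (auto simp: F_def)
  qed
  moreover have "\<And>M. M \<in> F \<Longrightarrow> maximalideal M R \<and> \<not> K \<subseteq> M" by (simp add: F_def)
  ultimately have "\<exists>k\<in>K. \<forall>M\<in>F. r \<oplus> k \<notin> M"
    by (rule exists_shift_avoiding_maximalideals[OF _ _ K r])
  then obtain k where k: "k \<in> K" "\<And>M. M \<in> F \<Longrightarrow> r \<oplus> k \<notin> M" by blast
  have kc: "k \<in> carrier R" using k(1) by (rule K.Icarr)
  have "s \<oplus> l \<notin> M" if M: "maximalideal M R" "r \<oplus> k \<in> M" for M
  proof
    assume sl: "s \<oplus> l \<in> M"
    interpret M: maximalideal M R by fact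
    have KM: "K \<subseteq> M" using k(2)[of M] M sl unfolding F_def by blast
    have "r = (r \<oplus> k) \<oplus> \<ominus> k" "s = (s \<oplus> l) \<oplus> \<ominus> l" using r s kc lc by algebra+
    then have "r \<in> M" "s \<in> M"
      using KM k(1) l(1) M(2) sl by (metis M.a_closed M.a_inv_closed subsetD)+
    then show False using unim[OF M(1) KM] by simp
  qed
  then have "(r \<oplus> k, s \<oplus> l) \<in> unimodular_pairs R"
    using r s kc lc by (intro unimodular_pairsI_maximalideal a_closed)
  then show ?thesis by (rule that[OF k(1) l(1)])
qed

section \<open>Congruence conditions modulo two comaximal ideals\<close>

lemma (in primeideal) subset_or_subset_of_inter_subset:
  assumes "ideal A R" "ideal B R" "A \<inter> B \<subseteq> I"
  shows "A \<subseteq> I \<or> B \<subseteq> I"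
  using primeideal_divides_ideal_prod[OF primeideal assms(1,2)] ideal_prod_inter[OF assms(1,2)]
    assms(3) by blast

lemma (in ideal) minus_closed:
  assumes "x \<in> I" "y \<in> I"
  shows "x \<ominus> y \<in> I"
  using assms by (simp add: minus_eq)

text \<open>The Chinese remainder theorem, applied to each entry, gives a pair with the right
  congruences. A maximal ideal above \<open>I \<inter> J\<close> contains \<open>I\<close> or
  \<open>J\<close>, and there the pair agrees with \<open>(a, b)\<close> or \<open>(c, d)\<close>;
  hence it lifts modulo \<open>I \<inter> J\<close>.\<close>

lemma (in cring) exists_unimodular_congruent:
  assumes fin: "\<And>x. x \<in> carrier R \<Longrightarrow> x \<noteq> \<zero> \<Longrightarrow> finite {M. maximalideal M R \<and> x \<in> M}"
    and I: "ideal I R" and J: "ideal J R" and IJ: "I <+>\<^bsub>R\<^esub> J = carrier R"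
    and ab: "(a, b) \<in> unimodular_pairs R" and cd: "(c, d) \<in> unimodular_pairs R"
  obtains r s where "(r, s) \<in> unimodular_pairs R"
    "r \<ominus> a \<in> I" "s \<ominus> b \<in> I" "r \<ominus> c \<in> J" "s \<ominus> d \<in> J"
proof -
  interpret I: ideal I R by fact
  interpret J: ideal J R by fact
  \<comment> \<open>Otherwise \<open>p\<close> and \<open>q\<close> would lie in \<open>M\<close>,
    and with them their combination \<open>\<one>\<close>.\<close>
  have in_both: False
    if pq: "(p, q) \<in> unimodular_pairs R" and M: "maximalideal M R" "x \<in> M" "y \<in> M"
      "x \<ominus> p \<in> M" "y \<ominus> q \<in> M" for p q x y M
  proof -
    interpret M: maximalideal M R by fact
    obtain u v where uv: "p \<in> carrier R" "q \<in> carrier R" "u \<in> carrier R" "v \<in> carrier R"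
        "u \<otimes> p \<oplus> v \<otimes> q = \<one>"
      using pq by (auto simp: unimodular_pairs_iff)
    have "x \<in> carrier R" "y \<in> carrier R" using M by auto
    then have "p = x \<ominus> (x \<ominus> p)" "q = y \<ominus> (y \<ominus> q)" using uv(1,2) by algebra+
    then have "p \<in> M" "q \<in> M" using M by (metis M.minus_closed)+
    then have "u \<otimes> p \<oplus> v \<otimes> q \<in> M" using uv(3,4) by (intro M.a_closed M.I_l_closed)
    then show False using uv(5) M.one_imp_carrier M.I_notcarr by auto
  qed
  have carr: "a \<in> carrier R" "b \<in> carrier R" "c \<in> carrier R" "d \<in> carrier R"
    using ab cd by (auto simp: unimodular_pairs_iff)
  have "\<one> \<in> I <+>\<^bsub>R\<^esub> J" using IJ by simp
  then obtain i j where ij: "i \<in> I" "j \<in> J" "\<one> = i \<oplus> j"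
    unfolding set_add_def' by blast
  then have ijc: "i \<in> carrier R" "j \<in> carrier R" by auto
  have comb: "\<exists>z\<in>carrier R. z \<ominus> x \<in> I \<and> z \<ominus> y \<in> J"
    if "x \<in> carrier R" "y \<in> carrier R" for x y
  proof -
    \<comment> \<open>Since \<open>i\<close> is 0 modulo \<open>I\<close> and 1 modulo
      \<open>J\<close>, and \<open>j\<close> the reverse, the solution is
      \<open>i \<otimes> y \<oplus> j \<otimes> x\<close>. The factor \<open>i \<oplus> j\<close> is
      kept so that both equations are formal ring identities.\<close>
    have "i \<otimes> y \<oplus> j \<otimes> x \<ominus> (i \<oplus> j) \<otimes> x = i \<otimes> (y \<ominus> x)"
      "i \<otimes> y \<oplus> j \<otimes> x \<ominus> (i \<oplus> j) \<otimes> y = j \<otimes> (x \<ominus> y)"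
      using that ijc by algebra+
    then have "i \<otimes> y \<oplus> j \<otimes> x \<ominus> x = i \<otimes> (y \<ominus> x)" "i \<otimes> y \<oplus> j \<otimes> x \<ominus> y = j \<otimes> (x \<ominus> y)"
      using that by (simp_all add: ij(3)[symmetric])
    then show ?thesis
      using ij(1,2) ijc that
      by (intro bexI[of _ "i \<otimes> y \<oplus> j \<otimes> x"]) (simp_all add: I.I_r_closed J.I_r_closed)
  qed
  obtain r where r: "r \<in> carrier R" "r \<ominus> a \<in> I" "r \<ominus> c \<in> J" using comb carr by blast
  obtain s where s: "s \<in> carrier R" "s \<ominus> b \<in> I" "s \<ominus> d \<in> J" using comb carr by blast
  have "s \<notin> M" if M: "maximalideal M R" "I \<inter> J \<subseteq> M" "r \<in> M" for M
  proof
    assume sM: "s \<in> M"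
    have "I \<subseteq> M \<or> J \<subseteq> M"
      using primeideal.subset_or_subset_of_inter_subset[OF maximalideal_prime[OF M(1)] I J M(2)] .
    then show False
      using in_both[OF ab M(1,3) sM] in_both[OF cd M(1,3) sM] r(2,3) s(2,3) by auto
  qed
  then obtain k l where kl: "k \<in> I \<inter> J" "l \<in> I \<inter> J" "(r \<oplus> k, s \<oplus> l) \<in> unimodular_pairs R"
    using exists_unimodular_lift[OF fin i_intersect[OF I J] r(1) s(1)] by blast
  have shift: "x \<oplus> y \<ominus> z \<in> A"
    if "ideal A R" "x \<in> carrier R" "z \<in> carrier R" "y \<in> A" "x \<ominus> z \<in> A" for x y z A
  proof -
    interpret A: ideal A R by fact
    have "y \<in> carrier R" using that by auto
    then have "x \<oplus> y \<ominus> z = (x \<ominus> z) \<oplus> y" using that(2,3) by algebra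
    then show ?thesis using A.a_closed[OF that(5,4)] by simp
  qed
  show ?thesis
  proof (rule that[OF kl(3)])
    show "r \<oplus> k \<ominus> a \<in> I" using shift[OF I r(1) carr(1) _ r(2)] kl(1) by blast
    show "s \<oplus> l \<ominus> b \<in> I" using shift[OF I s(1) carr(2) _ s(2)] kl(2) by blast
    show "r \<oplus> k \<ominus> c \<in> J" using shift[OF J r(1) carr(3) _ r(3)] kl(1) by blast
    show "s \<oplus> l \<ominus> d \<in> J" using shift[OF J s(1) carr(4) _ s(3)] kl(2) by blast
  qed
qed

section \<open>Construction of the matrix\<close>

lemma (in cring) ideal_of_maximal_ideal_monoid:
  assumes "I \<in> maximal_ideal_monoid R"
  shows "ideal I R"
  using assms
proof induction
  case one
  show ?case by (rule oneideal)
next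
  case (mult M I)
  then show ?case by (simp add: ideal_prod_is_ideal maximalideal.axioms(1))
qed

lemma (in cring) PF1_class_eqI:
  assumes I: "ideal I R" and "(a, b) \<in> unimodular_pairs R" "(c, d) \<in> unimodular_pairs R"
    and "a \<otimes> d \<ominus> b \<otimes> c \<in> I"
  shows "PF1_class R I a b = PF1_class R I c d"
  unfolding PF1_class_def
  by (rule equiv_class_eq[OF equiv_PF1_rel[OF I]]) (use assms in \<open>simp add: PF1_rel_def\<close>)

lemma (in cring) exists_SL2_rows:
  assumes fin: "\<And>x. x \<in> carrier R \<Longrightarrow> x \<noteq> \<zero> \<Longrightarrow> finite {M. maximalideal M R \<and> x \<in> M}"
    and I: "ideal I R" and J: "ideal J R" and IJ: "I <+>\<^bsub>R\<^esub> J = carrier R"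
    and ab: "(a, b) \<in> unimodular_pairs R" and cd: "(c, d) \<in> unimodular_pairs R"
  obtains a' b' c' d' where "((a', b'), (c', d')) \<in> SL2 R"
    "a' \<otimes> b \<ominus> b' \<otimes> a \<in> I" "c' \<otimes> d \<ominus> d' \<otimes> c \<in> J"
proof -
  interpret I: ideal I R by fact
  interpret J: ideal J R by fact
  obtain u v where uv: "u \<in> carrier R" "v \<in> carrier R" "u \<otimes> a \<oplus> v \<otimes> b = \<one>"
    using ab by (auto simp: unimodular_pairs_iff)
  obtain w z where wz: "w \<in> carrier R" "z \<in> carrier R" "w \<otimes> c \<oplus> z \<otimes> d = \<one>"
    using cd by (auto simp: unimodular_pairs_iff)
  have carr: "a \<in> carrier R" "b \<in> carrier R" "c \<in> carrier R" "d \<in> carrier R"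
    using ab cd by (auto simp: unimodular_pairs_iff)
  \<comment> \<open>The row \<open>(c, d)\<close> times the inverse of the matrix with rows \<open>(a, b)\<close>, \<open>(-v, u)\<close>.\<close>
  define e where "e = c \<otimes> u \<oplus> d \<otimes> v"
  define f where "f = d \<otimes> a \<ominus> c \<otimes> b"
  have ef: "e \<in> carrier R" "f \<in> carrier R" using carr uv by (simp_all add: e_def f_def)
  have "e \<otimes> a \<ominus> f \<otimes> v = c \<otimes> (u \<otimes> a \<oplus> v \<otimes> b)" "e \<otimes> b \<oplus> f \<otimes> u = d \<otimes> (u \<otimes> a \<oplus> v \<otimes> b)"
    unfolding e_def f_def using carr uv(1,2) by algebra+
  then have cd_eq: "e \<otimes> a \<ominus> f \<otimes> v = c" "e \<otimes> b \<oplus> f \<otimes> u = d" using carr by (simp_all add: uv(3))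
  \<comment> \<open>Rewriting \<open>w \<otimes> c \<oplus> z \<otimes> d\<close> in terms of
    \<open>e\<close> and \<open>f\<close> turns the relation for \<open>(c, d)\<close> into one for
    \<open>(e, f)\<close>.\<close>
  have "(w \<otimes> a \<oplus> z \<otimes> b) \<otimes> e \<oplus> (z \<otimes> u \<ominus> w \<otimes> v) \<otimes> f =
      w \<otimes> (e \<otimes> a \<ominus> f \<otimes> v) \<oplus> z \<otimes> (e \<otimes> b \<oplus> f \<otimes> u)"
    using carr uv(1,2) wz(1,2) ef by algebra
  then have "(e, f) \<in> unimodular_pairs R"
    unfolding cd_eq wz(3) unimodular_pairs_iff using carr uv(1,2) wz(1,2) ef by blast
  moreover have "(\<zero>, \<one>) \<in> unimodular_pairs R"
    by (auto simp: unimodular_pairs_iff)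
  ultimately obtain r s where rs: "(r, s) \<in> unimodular_pairs R"
    "r \<ominus> \<zero> \<in> I" "s \<ominus> \<one> \<in> I" "r \<ominus> e \<in> J" "s \<ominus> f \<in> J"
    using exists_unimodular_congruent[OF fin I J IJ] by blast
  obtain x y where xy: "r \<in> carrier R" "s \<in> carrier R" "x \<in> carrier R" "y \<in> carrier R"
      "x \<otimes> r \<oplus> y \<otimes> s = \<one>"
    using rs(1) by (auto simp: unimodular_pairs_iff)
  \<comment> \<open>The row \<open>(y, -x)\<close> completes \<open>(r, s)\<close> to determinant
    one. Adding \<open>x\<close> times \<open>(r, s)\<close> keeps the determinant and turns the
    second entry into a multiple of \<open>s \<ominus> \<one>\<close>, which lies in
    \<open>I\<close>.\<close>
  define p where "p = y \<oplus> x \<otimes> r"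
  define q where "q = x \<otimes> (s \<ominus> \<one>)"
  have qI: "q \<in> I" using rs xy by (simp add: q_def I.I_l_closed)
  have pq: "p \<in> carrier R" "q \<in> carrier R" using xy by (simp_all add: p_def q_def)
  have "p \<otimes> s \<ominus> q \<otimes> r = x \<otimes> r \<oplus> y \<otimes> s"
    unfolding p_def q_def using xy(1-4) by algebra
  then have pqrs: "p \<otimes> s \<ominus> q \<otimes> r = \<one>" using xy(5) by simp
  \<comment> \<open>The matrix with rows \<open>(p, q)\<close>, \<open>(r, s)\<close> is multiplied
    on the right by the one with rows \<open>(a, b)\<close>, \<open>(-v, u)\<close>, which undoes
    the reduction and has determinant one.\<close>
  define a' where "a' = p \<otimes> a \<ominus> q \<otimes> v"
  define b' where "b' = p \<otimes> b \<oplus> q \<otimes> u"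
  define c' where "c' = r \<otimes> a \<ominus> s \<otimes> v"
  define d' where "d' = r \<otimes> b \<oplus> s \<otimes> u"
  note defs = a'_def b'_def c'_def d'_def
  have "a' \<otimes> d' \<ominus> b' \<otimes> c' = (p \<otimes> s \<ominus> q \<otimes> r) \<otimes> (u \<otimes> a \<oplus> v \<otimes> b)"
    unfolding defs using carr uv(1,2) pq xy(1,2) by algebra
  then have "a' \<otimes> d' \<ominus> b' \<otimes> c' = \<one>" by (simp add: pqrs uv(3))
  then have "((a', b'), (c', d')) \<in> SL2 R"
    using carr uv(1,2) pq xy(1,2) by (simp add: SL2_def defs)
  \<comment> \<open>The term with \<open>p\<close> cancels, so membership of \<open>q\<close> in
    \<open>I\<close> is all that the first class requires.\<close>
  moreover have "a' \<otimes> b \<ominus> b' \<otimes> a = \<ominus> q \<otimes> (u \<otimes> a \<oplus> v \<otimes> b)"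
    unfolding defs using carr uv(1,2) pq by algebra
  then have "a' \<otimes> b \<ominus> b' \<otimes> a \<in> I" using qI pq by (simp add: uv(3))
  moreover have "c' \<otimes> d \<ominus> d' \<otimes> c \<in> J"
  proof -
    \<comment> \<open>Both \<open>(c', d')\<close> and \<open>(c, d)\<close> are images under the
      same matrix, of \<open>(r, s)\<close> and \<open>(e, f)\<close>. Their cross determinant is
      therefore \<open>r \<otimes> f \<ominus> s \<otimes> e\<close> times that matrix's
      determinant, regrouped here to expose the congruences modulo \<open>J\<close>.\<close>
    have "c' \<otimes> (e \<otimes> b \<oplus> f \<otimes> u) \<ominus> d' \<otimes> (e \<otimes> a \<ominus> f \<otimes> v) =
        (f \<otimes> (r \<ominus> e) \<ominus> e \<otimes> (s \<ominus> f)) \<otimes> (u \<otimes> a \<oplus> v \<otimes> b)"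
      unfolding defs using carr uv(1,2) xy(1,2) ef by algebra
    also have "\<dots> = f \<otimes> (r \<ominus> e) \<ominus> e \<otimes> (s \<ominus> f)" using xy(1,2) ef by (simp add: uv(3))
    also have "\<dots> \<in> J" using rs ef by (simp add: J.minus_closed[OF J.I_l_closed J.I_l_closed])
    finally show ?thesis unfolding cd_eq .
  qed
  ultimately show ?thesis using that by blast
qed

lemma (in field) maximalideal_eq_zero:
  assumes "maximalideal M R"
  shows "M = {\<zero>}"
  using assms all_ideals maximalideal.I_notcarr[OF assms] by (auto simp: maximalideal_def)

text \<open>In the field case of \<open>dedekind_type\<close> the set is empty, because a maximal
  ideal of a field is zero; otherwise finiteness is part of the definition.\<close>

lemma dedekind_type_finite_maximalideals:
  fixes R (structure)
  assumes R: "dedekind_type R" and x: "x \<in> carrier R" "x \<noteq> \<zero>"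
  shows "finite {M. maximalideal M R \<and> x \<in> M}"
proof (cases "field R")
  case True
  then have "{M. maximalideal M R \<and> x \<in> M} = {}"
    using field.maximalideal_eq_zero[OF True] x(2) by auto
  then show ?thesis by (simp only: finite.emptyI)
next
  case False
  then show ?thesis using R x by (simp add: dedekind_type_def)
qed

theorem mainTheorem12:
  fixes R :: "('a, 'b) ring_scheme" (structure) and I J :: "'a set"
  assumes "dedekind_type R"
    and "I \<in> maximal_ideal_monoid R" and "J \<in> maximal_ideal_monoid R"
    and "I <+> J = carrier R"
  shows "row_classes R I J ` SL2 R = PF1 R I \<times> PF1 R J"
proof -
  interpret cring R using assms(1) by (simp add: dedekind_type_def)
  note I = ideal_of_maximal_ideal_monoid[OF assms(2)]
  note J = ideal_of_maximal_ideal_monoid[OF assms(3)]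
  note fin = dedekind_type_finite_maximalideals[OF assms(1)]
  show ?thesis
  proof (intro equalityI subsetI)
    fix y assume "y \<in> row_classes R I J ` SL2 R"
    then show "y \<in> PF1 R I \<times> PF1 R J"
      using SL2_rows_unimodular
      by (auto simp: row_classes_def PF1_def PF1_class_def intro!: quotientI)
  next
    fix y assume "y \<in> PF1 R I \<times> PF1 R J"
    then obtain a b c d where
      abcd: "(a, b) \<in> unimodular_pairs R" "(c, d) \<in> unimodular_pairs R"
      and y: "y = (PF1_class R I a b, PF1_class R J c d)"
      by (auto simp: PF1_def PF1_class_def elim!: quotientE)
    obtain a' b' c' d' where m: "((a', b'), (c', d')) \<in> SL2 R"
      "a' \<otimes> b \<ominus> b' \<otimes> a \<in> I" "c' \<otimes> d \<ominus> d' \<otimes> c \<in> J"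
      using exists_SL2_rows[OF fin I J assms(4) abcd] by blast
    have "y = row_classes R I J ((a', b'), (c', d'))"
      using PF1_class_eqI[OF I _ abcd(1) m(2)] PF1_class_eqI[OF J _ abcd(2) m(3)]
        SL2_rows_unimodular[OF m(1)] by (simp add: y row_classes_def)
    then show "y \<in> row_classes R I J ` SL2 R" using m(1) by blast
  qed
qed

end
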